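(* Let $\lambda>0$ be real, let $x$ be a real number and let $n\ge 0$ be an integer. Then $$x^{n}=\sum_{k=0}^{n+1}\Lambda_{n,k}\,\Delta_{n+1-k,k}(x,\lambda),\qquad \Lambda_{n,k}=\frac{1}{2^{n+1}(n+1)}\binom{n+1}{k},$$ where $$\Delta_{m,k}(x,\lambda)=\det\begin{pmatrix}\lambda\,\mathfrak{B}_{m}(x+1;\lambda) & \mathfrak{E}_{k}(x;\lambda)\\ \mathfrak{B}_{m}(x;\lambda) & \lambda\,\mathfrak{E}_{k}(x+1;\lambda)\end{pmatrix}=\lambda^{2}\mathfrak{B}_{m}(x+1;\lambda)\mathfrak{E}_{k}(x+1;\lambda)-\mathfrak{B}_{m}(x;\lambda)\mathfrak{E}_{k}(x;\lambda).$$
   Context: For a real parameter $\lambda$, the Apostol-Bernoulli polynomials $\mathfrak{B}_n(x;\lambda)$ and Apostol-Euler polynomials $\mathfrak{E}_n(x;\lambda)$ are defined by the Taylor expansions at $t=0$ $$\frac{t}{\lambda e^{t}-1}e^{xt}=\sum_{n\ge0}\mathfrak{B}_n(x;\lambda)\frac{t^n}{n!},\qquad \frac{2}{\lambda e^{t}+1}e^{xt}=\sum_{n\ge0}\mathfrak{E}_n(x;\lambda)\frac{t^n}{n!}.$$ *)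

theory Defs
  imports "HOL-Analysis.Analysis"
begin

(* The Taylor expansions at t = 0 are taken in the ring of formal power series over the reals, where
   division cancels common powers of t; for l = 1 this removes the singularity of
   t / (exp t - 1) at 0. For l = -1 the Euler generating function has a pole at 0 and the values of
   apostol_euler are meaningless. The two expansion lemmas at the end of the theory relate the
   definitions to the functions of t they come from. *)

definition apostol_bernoulli :: "real \<Rightarrow> nat \<Rightarrow> real \<Rightarrow> real" where
  "apostol_bernoulli l n x =
     fact n * fps_nth (fps_X / (fps_const l * fps_exp 1 - 1) * fps_exp x) n"

definition apostol_euler :: "real \<Rightarrow> nat \<Rightarrow> real \<Rightarrow> real" where
  "apostol_euler l n x =
     fact n * fps_nth (2 / (fps_const l * fps_exp 1 + 1) * fps_exp x) n"

definition Delta :: "nat \<Rightarrow> nat \<Rightarrow> real \<Rightarrow> real \<Rightarrow> real" where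
  "Delta m k x l =
     det (vector
       [vector [l * apostol_bernoulli l m (x + 1), apostol_euler l k x],
        vector [apostol_bernoulli l m x, l * apostol_euler l k (x + 1)]] :: real^2^2)"

definition Lambda :: "nat \<Rightarrow> nat \<Rightarrow> real" where
  "Lambda n k = 1 / (2 ^ (n + 1) * real (n + 1)) * real ((n + 1) choose k)"

lemma Delta_expand:
  "Delta m k x l =
     l\<^sup>2 * apostol_bernoulli l m (x + 1) * apostol_euler l k (x + 1)
       - apostol_bernoulli l m x * apostol_euler l k x"
  by (simp add: Delta_def det_2 vector_2 power2_eq_square algebra_simps)

lemma subdegree_bernoulli_denom:
  "fps_const l * fps_exp 1 - 1 \<noteq> (0 :: real fps)"
  "subdegree (fps_const l * fps_exp 1 - 1 :: real fps) = (if l = 1 then 1 else 0)"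
proof -
  let ?G = "fps_const l * fps_exp 1 - 1 :: real fps"
  have 0: "fps_nth ?G 0 = l - 1" and 1: "fps_nth ?G 1 = l"
    by simp_all
  show "?G \<noteq> 0"
  proof
    assume "?G = 0"
    hence "fps_nth ?G 0 = 0" "fps_nth ?G 1 = 0" by simp_all
    thus False using 0 1 by simp
  qed
  show "subdegree ?G = (if l = 1 then 1 else 0)"
  proof (cases "l = 1")
    case True
    have "subdegree ?G = 1"
      by (rule subdegreeI) (use 0 1 True in auto)
    thus ?thesis using True by simp
  next
    case False
    thus ?thesis using 0 by (simp add: subdegree_eq_0_iff)
  qed
qed

lemma apostol_bernoulli_expansion:
  "(\<lambda>t. (if t = 0 then if l = 1 then 1 else 0 else t / (l * exp t - 1)) * exp (x * t))
     has_fps_expansion Abs_fps (\<lambda>n. apostol_bernoulli l n x / fact n)"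
proof -
  let ?G = "fps_const l * fps_exp 1 - 1 :: real fps"
  have eq: "Abs_fps (\<lambda>n. apostol_bernoulli l n x / fact n) = fps_X / ?G * fps_exp x"
    by (rule fps_ext) (simp add: apostol_bernoulli_def)
  have "(\<lambda>t. if t = 0 then if l = 1 then 1 else 0 else t / (l * exp t - 1))
          has_fps_expansion fps_X / ?G"
  proof (rule has_fps_expansion_divide)
    show "(\<lambda>t. t) has_fps_expansion (fps_X :: real fps)"
      by (rule has_fps_expansion_fps_X)
    show "(\<lambda>t. l * exp t - 1) has_fps_expansion ?G"
      using has_fps_expansion_exp[of 1]
      by (auto intro!: fps_expansion_intros)
    show "(if l = 1 then 1 else 0) = fps_nth fps_X (subdegree ?G) / fps_nth ?G (subdegree ?G)"
      unfolding subdegree_bernoulli_denom by simp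
  qed (use subdegree_bernoulli_denom in auto)
  thus ?thesis unfolding eq
    by (intro has_fps_expansion_mult has_fps_expansion_exp)
qed

lemma apostol_euler_expansion:
  assumes "l \<noteq> -1"
  shows "(\<lambda>t. 2 / (l * exp t + 1) * exp (x * t))
           has_fps_expansion Abs_fps (\<lambda>n. apostol_euler l n x / fact n)"
proof -
  let ?G = "fps_const l * fps_exp 1 + 1 :: real fps"
  have eq: "Abs_fps (\<lambda>n. apostol_euler l n x / fact n) = 2 / ?G * fps_exp x"
    by (rule fps_ext) (simp add: apostol_euler_def)
  have nz: "fps_nth ?G 0 \<noteq> 0"
    using assms by (simp add: add_eq_0_iff2)
  have "(\<lambda>t. 2 / (l * exp t + 1)) has_fps_expansion 2 / ?G"
  proof (rule has_fps_expansion_divide')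
    show "(\<lambda>t. 2) has_fps_expansion (2 :: real fps)"
      by (rule has_fps_expansion_numeral)
    show "(\<lambda>t. l * exp t + 1) has_fps_expansion ?G"
      using has_fps_expansion_exp[of 1]
      by (auto intro!: fps_expansion_intros)
  qed (use nz in auto)
  thus ?thesis unfolding eq
    by (intro has_fps_expansion_mult has_fps_expansion_exp)
qed

end

theory Submission
  imports Defs
begin

text \<open>
  Put \<open>G = \<lambda> e\<^sup>t\<close>. Shifting \<open>x\<close> to \<open>x + 1\<close> and scaling by \<open>\<lambda>\<close> multiplies either generating function
  by \<open>G\<close>, so the binomial convolution of the determinants has the exponential generating function
  \<open>(G\<^sup>2 - 1) \<cdot> t / (G - 1) \<cdot> 2 / (G + 1) \<cdot> e\<^bsup>2xt\<^esup> = 2 t e\<^bsup>2xt\<^esup>\<close>.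
\<close>

text \<open>Binomial convolution is multiplication of exponential generating functions. The Euler
  series stands first because \<open>fps_mult_nth\<close> gives the index \<open>k\<close> to the
  left factor.\<close>

lemma sum_binomial_apostol:
  "(\<Sum>k = 0..N. real (N choose k) * (apostol_bernoulli l (N - k) y * apostol_euler l k z)) =
     fact N * fps_nth ((2 / (fps_const l * fps_exp 1 + 1) * fps_exp z) *
       (fps_X / (fps_const l * fps_exp 1 - 1) * fps_exp y)) N"
  unfolding fps_mult_nth[of "_ / _ * _" "_ / _ * _"] sum_distrib_left
  by (intro sum.cong) (simp_all add: apostol_bernoulli_def apostol_euler_def binomial_fact)

lemma apostol_generating_function_identity:
  fixes l x :: real
  defines "G \<equiv> fps_const l * fps_exp 1"
  assumes "l \<noteq> -1"
  shows "fps_const (l\<^sup>2) *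
           ((2 / (G + 1) * fps_exp (x + 1)) * (fps_X / (G - 1) * fps_exp (x + 1)))
         - (2 / (G + 1) * fps_exp x) * (fps_X / (G - 1) * fps_exp x)
         = fps_const 2 * fps_X * fps_exp (2 * x)"
proof -
  define P where "P = fps_X / (G - 1)"
  define Q where "Q = 2 / (G + 1)"
  \<comment> \<open>For \<open>l = 1\<close> the series \<open>G - 1\<close> is not a unit, but its
    subdegree is then 1, so it still divides \<open>fps_X\<close>.\<close>
  have "(G - 1) dvd fps_X"
    unfolding G_def using subdegree_bernoulli_denom[of l] by (simp add: fps_dvd_iff)
  hence P: "P * (G - 1) = fps_X"
    unfolding P_def by simp
  \<comment> \<open>The constant term is \<open>l + 1\<close>, so \<open>G + 1\<close> is a
    unit.\<close>
  have "fps_nth (G + 1) 0 \<noteq> 0"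
    using assms by (simp add: G_def add_eq_0_iff2)
  hence "(G + 1) dvd 2"
    by (metis fps_is_unit_iff unit_imp_dvd)
  hence Q: "Q * (G + 1) = 2"
    unfolding Q_def by simp
  have G2: "fps_const (l\<^sup>2) * (fps_exp 1 * fps_exp 1) = G * G"
    by (simp add: G_def power2_eq_square fps_const_mult[symmetric] mult_ac del: fps_const_mult)
  have "fps_const (l\<^sup>2) * ((Q * fps_exp (x + 1)) * (P * fps_exp (x + 1)))
          - (Q * fps_exp x) * (P * fps_exp x)
        = (fps_const (l\<^sup>2) * (fps_exp 1 * fps_exp 1) - 1) * P * Q * (fps_exp x * fps_exp x)"
    by (simp add: fps_exp_add_mult algebra_simps)
  also have "\<dots> = (P * (G - 1)) * (Q * (G + 1)) * (fps_exp x * fps_exp x)"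
    unfolding G2 by (simp add: algebra_simps)
  also have "\<dots> = fps_const 2 * fps_X * fps_exp (2 * x)"
    unfolding P Q
    by (simp add: fps_exp_add_mult[symmetric] numeral_fps_const[symmetric] mult_ac)
  finally show ?thesis
    unfolding P_def Q_def .
qed

theorem theorem1:
  fixes l x :: real and n :: nat
  assumes "l > 0"
  shows "x ^ n = (\<Sum>k = 0..n + 1. Lambda n k * Delta (n + 1 - k) k x l)"
proof -
  let ?N = "n + 1"
  let ?S = "\<lambda>y. \<Sum>k = 0..?N. real (?N choose k) *
              (apostol_bernoulli l (?N - k) y * apostol_euler l k y)"
  have "(\<Sum>k = 0..?N. Lambda n k * Delta (?N - k) k x l) =
          1 / (2 ^ ?N * real ?N) * (l\<^sup>2 * ?S (x + 1) - ?S x)"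
    unfolding Delta_expand Lambda_def sum_distrib_left sum_subtractf[symmetric]
    by (intro sum.cong) (simp_all only: algebra_simps)
  also have "l\<^sup>2 * ?S (x + 1) - ?S x =
               fact ?N * fps_nth (fps_const 2 * fps_X * fps_exp (2 * x)) ?N"
    unfolding sum_binomial_apostol
    by (subst apostol_generating_function_identity[of l x, symmetric])
      (use assms in \<open>simp_all only: fps_sub_nth fps_mult_left_const_nth, simp_all add: right_diff_distrib\<close>)
  \<comment> \<open>The factor \<open>fps_X\<close> lowers the index to \<open>n\<close>: the
    coefficient is \<open>2 * (2 * x) ^ n / fact n\<close>, and \<open>fact (n + 1) / fact n\<close>
    is \<open>n + 1\<close>.\<close>
  also have "\<dots> = 2 ^ ?N * real ?N * x ^ n"
    by (simp add: mult.assoc power_mult_distrib)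
  finally show ?thesis
    by simp
qed

end
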